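(* Consider the model of observing $X$ with $dX(t)=\sigma_X(t)dB(t)$ at times $i/n$, $i=0,\dots,n$, and arbitrary parameters $1\le r<d$, $\beta\in(0,1)$, $L>0$, $\underline\lambda_r>0$ as well as $\hbar\in(0,1]$. Then there is no non-trivial test between $\mathcal H_0$ and $\mathcal H_1$: whenever $0<c\le 2^{-5/2}\pi^{-1}$, for all tests $\varphi$ $$\sup_{\Sigma\in\mathcal H_0(r,\beta,L,0)}\mathbb E_\Sigma[\varphi]+\sup_{\Sigma\in\mathcal H_1(r,\hbar,cLn^{-\beta})}\mathbb E_\Sigma[1-\varphi]\ge1,$$ and for all tests $\varphi$ $$\sup_{\Sigma\in\mathcal H_0^{gap}(r,\beta,L,0,\underline\lambda_r)}\mathbb E_\Sigma[\varphi]+\sup_{\Sigma\in\mathcal H_1(r,\hbar,(\underline\lambda_r^{-1}c^2L^2n^{-2\beta})\wedge(cLn^{-\beta}))}\mathbb E_\Sigma[1-\varphi]\ge1.$$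
   Context: Notation: $\mathbb R^{d\times d}_{spd}$ is the set of symmetric positive semi-definite matrices, $\lambda_1(S)\ge\dots\ge\lambda_d(S)$ are the ordered eigenvalues of a symmetric matrix, $\|\cdot\|$ is the spectral norm, $a\wedge b=\min(a,b)$. $B$ is a standard Brownian motion, $\sigma_X$ is deterministic and $\Sigma_X=\sigma_X\sigma_X^\top$, so that the observed increments $X(i/n)-X((i-1)/n)$ are independent $N(0,\int_{(i-1)/n}^{i/n}\Sigma_X(t)dt)$; $\mathbb E_\Sigma$ is the expectation when $\Sigma_X=\Sigma$. A test is a measurable $[0,1]$-valued function of the observations. Besov seminorm: $\omega_p(S,h)=\sup_{s\in[0,h]}(\int_0^{1-s}\|S(t+s)-S(t)\|^pdt)^{1/p}$ and $|S|_{B^\beta_{p,\infty}}=\sup_{0<h\le1}h^{-\beta}\omega_p(S,h)$. $\mathcal H_0(r,\beta,L,0)$ is the set of $\Sigma_X:[0,1]\to\mathbb R^{d\times d}_{spd}$ with $\sup_t\operatorname{rank}(\Sigma_X(t))\le r$ and $|\Sigma_X|_{B^\beta_{2,\infty}}\le L$ (no idiosyncratic component). $\mathcal H_0^{gap}(r,\beta,L,0,\underline\lambda_r)$ is the set of $\Sigma_X$ with $\sup_t\operatorname{rank}(\Sigma_X(t))\le r$, $\inf_t\lambda_r(\Sigma_X(t))\ge\underline\lambda_r$ and $|\Sigma_X|_{B^\beta_{4,\infty}}\le L$. $\mathcal H_1(r,\hbar,v)$ is the set of $\Sigma_X\in C([0,1];\mathbb R^{d\times d}_{spd})$ with $\sup_{|I|\ge\hbar}|I|\min_{t\in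 I}\lambda_{r+1}(\Sigma_X(t))\ge v$, the supremum being over intervals $I\subset[0,1]$ of length $|I|\ge\hbar$. *)

theory Defs
  imports "HOL-Probability.Probability" "HOL-Library.Multiset"
begin

subsection \<open>Symmetric matrices, eigenvalues and spectral norm\<close>

definition sym_psd :: "(real^'d^'d) set" where
  "sym_psd = {A. transpose A = A \<and> (\<forall>x. 0 \<le> x \<bullet> (A *v x))}"

definition spectral_norm :: "real^'d^'d \<Rightarrow> real" where
  "spectral_norm A = onorm ((*v) A)"

(* For symmetric A the geometric multiplicity is the algebraic one and the multiset below
   has CARD('d) elements. *)
definition eigenvalues :: "real^'d^'d \<Rightarrow> real multiset" where
  "eigenvalues A =
     (\<Sum>l\<in>{l. \<exists>v. v \<noteq> 0 \<and> A *v v = l *\<^sub>R v}. replicate_mset (dim {v. A *v v = l *\<^sub>R v}) l)"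

(* k-th largest eigenvalue counted with multiplicity, with k running from 1 to CARD('d). *)
definition eigval :: "nat \<Rightarrow> real^'d^'d \<Rightarrow> real" where
  "eigval k A = rev (sorted_list_of_multiset (eigenvalues A)) ! (k - 1)"

subsection \<open>Besov seminorm\<close>

(* Only used for exponents a > 0. *)
definition ennreal_powr :: "ennreal \<Rightarrow> real \<Rightarrow> ennreal" where
  "ennreal_powr x a = (if x = \<infinity> then \<infinity> else ennreal (enn2real x powr a))"

definition besov_modulus :: "real \<Rightarrow> (real \<Rightarrow> real^'d^'d) \<Rightarrow> real \<Rightarrow> ennreal" where
  "besov_modulus p S h =
     (SUP s\<in>{0..h}. ennreal_powr
        (\<integral>\<^sup>+ t\<in>{0..1-s}. ennreal (spectral_norm (S (t + s) - S t) powr p) \<partial>lebesgue) (1 / p))"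

definition besov_seminorm :: "real \<Rightarrow> real \<Rightarrow> (real \<Rightarrow> real^'d^'d) \<Rightarrow> ennreal" where
  "besov_seminorm \<beta> p S = (SUP h\<in>{0<..1}. ennreal (h powr - \<beta>) * besov_modulus p S h)"

subsection \<open>Hypotheses\<close>

(* Squared volatilities on [0,1]; values outside [0,1] are never used. Lebesgue integrability
   is what makes the covariances of the increments well defined. *)
definition spd_paths :: "(real \<Rightarrow> real^'d^'d) set" where
  "spd_paths = {S. (\<forall>t\<in>{0..1}. S t \<in> sym_psd) \<and> S absolutely_integrable_on {0..1}}"

definition H0 :: "nat \<Rightarrow> real \<Rightarrow> real \<Rightarrow> (real \<Rightarrow> real^'d^'d) set" where
  "H0 r \<beta> L = {S \<in> spd_paths.
     (SUP t\<in>{0..1}. rank (S t)) \<le> r \<and> besov_seminorm \<beta> 2 S \<le> ennreal L}"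

definition H0_gap :: "nat \<Rightarrow> real \<Rightarrow> real \<Rightarrow> real \<Rightarrow> (real \<Rightarrow> real^'d^'d) set" where
  "H0_gap r \<beta> L lr = {S \<in> spd_paths.
     (SUP t\<in>{0..1}. rank (S t)) \<le> r \<and> (INF t\<in>{0..1}. eigval r (S t)) \<ge> lr \<and>
     besov_seminorm \<beta> 4 S \<le> ennreal L}"

(* The intervals I are the compact ones, on which the minimum is attained. *)
definition H1 :: "nat \<Rightarrow> real \<Rightarrow> real \<Rightarrow> (real \<Rightarrow> real^'d^'d) set" where
  "H1 r hbar v = {S. continuous_on {0..1} S \<and> (\<forall>t\<in>{0..1}. S t \<in> sym_psd) \<and>
     (SUP (a, b)\<in>{(a, b). 0 \<le> a \<and> a \<le> b \<and> b \<le> 1 \<and> hbar \<le> b - a}.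
        (b - a) * (INF t\<in>{a..b}. eigval (r + 1) (S t))) \<ge> v}"

subsection \<open>Law of the observations\<close>

definition psd_sqrt :: "real^'d^'d \<Rightarrow> real^'d^'d" where
  "psd_sqrt A = (THE R. R \<in> sym_psd \<and> R ** R = A)"

definition std_gauss :: "(real^'d) measure" where
  "std_gauss = distr (\<Pi>\<^sub>M i\<in>UNIV. density lborel std_normal_density) borel (\<lambda>z. \<chi> i. z i)"

(* N(0,A), possibly degenerate, as the law of the square root of A applied to a standard
   Gaussian vector. *)
definition centered_gauss :: "real^'d^'d \<Rightarrow> (real^'d) measure" where
  "centered_gauss A = distr std_gauss borel (\<lambda>z. psd_sqrt A *v z)"

definition increments_law :: "nat \<Rightarrow> (real \<Rightarrow> real^'d^'d) \<Rightarrow> (nat \<Rightarrow> real^'d) measure" where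
  "increments_law n S =
     (\<Pi>\<^sub>M i\<in>{1..n}. centered_gauss (LINT t:{(real i - 1) / real n..real i / real n}|lebesgue. S t))"

abbreviation obs_space :: "nat \<Rightarrow> (nat \<Rightarrow> real^'d) measure" where
  "obs_space n \<equiv> \<Pi>\<^sub>M i\<in>{0..n}. borel"

(* Law of X(i/n), i = 0..n, for the solution of dX = sigma dB started at X(0) = x0. *)
definition obs_law :: "nat \<Rightarrow> real^'d \<Rightarrow> (real \<Rightarrow> real^'d^'d) \<Rightarrow> (nat \<Rightarrow> real^'d) measure" where
  "obs_law n x0 S =
     distr (increments_law n S) (obs_space n) (\<lambda>w. \<lambda>i\<in>{0..n}. x0 + (\<Sum>j=1..i. w j))"

definition tests :: "nat \<Rightarrow> ((nat \<Rightarrow> real^'d) \<Rightarrow> real) set" where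
  "tests n = {\<phi> \<in> borel_measurable (obs_space n). \<forall>y\<in>space (obs_space n). \<phi> y \<in> {0..1}}"

end

theory Submission
  imports Defs
begin

text \<open>
  Put \<open>K = c L n\<^sup>-\<^sup>\<beta>\<close> and fix \<open>m \<ge> K\<close>. The rank-one path \<open>w w\<^sup>T\<close> with
  \<open>w(t) = (\<surd>m, \<surd>(2/m) K cos(\<pi> n t))\<close> has the same integral over every observation cell
  \<open>[(i-1)/n, i/n]\<close> as the constant matrix \<open>diag(m, K\<^sup>2/m)\<close> of rank two: over one cell \<open>cos(\<pi> n t)\<close>
  averages to 0 and its square to 1/2. Padding both with \<open>r - 1\<close> eigenvalues \<open>m\<close> gives a path in the null
  hypothesis and one in the alternative under which the observations have the same law, so the two
  errors of a test add up to 1. The increments of the oscillating path have norm at most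
  \<open>4 \<surd>2 K min(1, \<pi> n s) \<le> L s\<^sup>\<beta>\<close>. The first claim uses \<open>m = K\<close>, the second
  \<open>m = max \<lambda> K\<close> with \<open>\<lambda>\<close> the required spectral gap.
\<close>

section \<open>Lower bounds for ordered eigenvalues\<close>

lemma sorted_desc_nth_ge:
  fixes ys :: "'a::linorder list"
  assumes "sorted_wrt (\<ge>) ys" "1 \<le> k" "k \<le> length (filter (\<lambda>y. x \<le> y) ys)"
  shows "x \<le> ys ! (k - 1)"
  using assms
proof (induction ys arbitrary: k)
  case (Cons y ys)
  show ?case
  proof (cases "x \<le> y")
    case True
    then show ?thesis
      using Cons.IH[of "k - 1"] Cons.prems by (cases "k = 1") (auto simp: nth_Cons')
  next
    case False
    \<comment> \<open>The head is the largest entry; if it is below \<open>x\<close>, the filter is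
      empty, against \<open>1 \<le> k\<close>.\<close>
    then have "filter (\<lambda>y. x \<le> y) (y # ys) = []"
      using Cons.prems(1) by (auto simp: filter_empty_conv dest: order_trans)
    then show ?thesis
      using Cons.prems by auto
  qed
qed auto

lemma sym_inner_matrix_vector:
  fixes A :: "real^'d^'d"
  assumes "transpose A = A"
  shows "(A *v x) \<bullet> y = x \<bullet> (A *v y)"
  using assms by (metis dot_lmul_matrix transpose_matrix_vector)

text \<open>Eigenvectors for distinct eigenvalues of a symmetric matrix are orthogonal, hence
  independent, hence finite in number. This matters because the sum in \<open>eigenvalues\<close>
  would be the empty multiset over an infinite index set.\<close>

lemma finite_spectrum_sym:
  fixes A :: "real^'d^'d"
  assumes sym: "transpose A = A"
  shows "finite {l. \<exists>v. v \<noteq> 0 \<and> A *v v = l *\<^sub>R v}" (is "finite ?\<Lambda>")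
proof -
  define e where "e l = (SOME v. v \<noteq> 0 \<and> A *v v = l *\<^sub>R v)" for l
  have e: "e l \<noteq> 0" "A *v e l = l *\<^sub>R e l" if "l \<in> ?\<Lambda>" for l
    using someI_ex[of "\<lambda>v. v \<noteq> 0 \<and> A *v v = l *\<^sub>R v"] that by (auto simp: e_def)
  have orth: "e l \<bullet> e m = 0" if "l \<in> ?\<Lambda>" "m \<in> ?\<Lambda>" "l \<noteq> m" for l m
  proof -
    have "l * (e l \<bullet> e m) = m * (e l \<bullet> e m)"
      using sym_inner_matrix_vector[OF sym, of "e l" "e m"] e that by simp
    then show ?thesis
      using that(3) by simp
  qed
  have inj: "inj_on e ?\<Lambda>"
  proof (rule inj_onI)
    fix l m assume "l \<in> ?\<Lambda>" "m \<in> ?\<Lambda>" "e l = e m"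
    then show "l = m"
      using orth[of l m] e(1)[of l] by fastforce
  qed
  have "pairwise orthogonal (e ` ?\<Lambda>)"
    using orth by (auto simp: pairwise_def orthogonal_def)
  moreover have "0 \<notin> e ` ?\<Lambda>"
    using e(1) by force
  ultimately have "independent (e ` ?\<Lambda>)"
    by (rule pairwise_orthogonal_independent)
  then have "finite (e ` ?\<Lambda>)"
    by (rule independent_imp_finite)
  then show ?thesis
    using inj by (rule finite_imageD)
qed

text \<open>Each vector of \<open>B\<close> lies in an eigenspace with \<open>l \<ge> x\<close>, and
  by independence at most \<open>dim (E l)\<close> of them share one. So the multiset of eigenvalues
  has at least \<open>card B\<close> entries from \<open>x\<close> upwards, and the
  \<open>k\<close>-th largest is among them.\<close>

lemma eigval_ge:
  fixes A :: "real^'d^'d"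
  assumes sym: "transpose A = A" and B: "independent B" "1 \<le> k" "k \<le> card B"
    and eig: "\<And>v. v \<in> B \<Longrightarrow> \<exists>l\<ge>x. A *v v = l *\<^sub>R v"
  shows "x \<le> eigval k A"
proof -
  define \<Lambda> where "\<Lambda> = {l. \<exists>v. v \<noteq> 0 \<and> A *v v = l *\<^sub>R v}"
  define E where "E l = {v. A *v v = l *\<^sub>R v}" for l
  have fin: "finite \<Lambda>"
    unfolding \<Lambda>_def by (rule finite_spectrum_sym[OF sym])
  have finB: "finite B"
    using B(1) by (rule independent_imp_finite)
  have "filter_mset (\<lambda>y. x \<le> y) (\<Sum>l\<in>F. replicate_mset (dim (E l)) l)
      = (\<Sum>l\<in>F. if x \<le> l then replicate_mset (dim (E l)) l else {#})" if "finite F" for F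
    using that
  proof (induction F rule: finite_induct)
    case (insert l F)
    have "filter_mset (\<lambda>y. x \<le> y) (replicate_mset (dim (E l)) l)
        = (if x \<le> l then replicate_mset (dim (E l)) l else {#})"
      by (induction "dim (E l)") (auto simp: filter_mset_eq_conv)
    then show ?case
      unfolding sum.insert[OF insert.hyps] filter_union_mset insert.IH by (rule arg_cong2) simp
  qed simp
  from this[OF fin]
  have "size (filter_mset (\<lambda>y. x \<le> y) (eigenvalues A)) = (\<Sum>l\<in>\<Lambda>. if x \<le> l then dim (E l) else 0)"
    unfolding eigenvalues_def \<Lambda>_def[symmetric] E_def[symmetric]
    by (auto simp: size_multiset_sum intro!: sum.cong)
  moreover have "card B \<le> (\<Sum>l\<in>\<Lambda>. if x \<le> l then dim (E l) else 0)"
  proof -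
    have "B \<subseteq> (\<Union>l\<in>{l\<in>\<Lambda>. x \<le> l}. B \<inter> E l)"
    proof
      fix v assume v: "v \<in> B"
      then obtain l where l: "x \<le> l" "A *v v = l *\<^sub>R v"
        using eig by blast
      have "v \<noteq> 0"
        using v B(1) dependent_zero by blast
      then show "v \<in> (\<Union>l\<in>{l\<in>\<Lambda>. x \<le> l}. B \<inter> E l)"
        using v l unfolding \<Lambda>_def E_def by blast
    qed
    then have "card B \<le> card (\<Union>l\<in>{l\<in>\<Lambda>. x \<le> l}. B \<inter> E l)"
      using fin finB by (intro card_mono) auto
    also have "\<dots> \<le> (\<Sum>l\<in>{l\<in>\<Lambda>. x \<le> l}. card (B \<inter> E l))"
      using fin by (intro card_UN_le) auto
    also have "\<dots> \<le> (\<Sum>l\<in>{l\<in>\<Lambda>. x \<le> l}. dim (E l))"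
      using B(1) by (intro sum_mono independent_card_le_dim) (auto simp: independent_mono[OF B(1)])
    also have "\<dots> = (\<Sum>l\<in>\<Lambda>. if x \<le> l then dim (E l) else 0)"
      using fin by (simp add: sum.inter_filter)
    finally show ?thesis .
  qed
  ultimately have "k \<le> size (filter_mset (\<lambda>y. x \<le> y) (eigenvalues A))"
    using B(3) by simp
  also have "\<dots> = length (filter (\<lambda>y. x \<le> y) (rev (sorted_list_of_multiset (eigenvalues A))))"
    by (metis mset_filter mset_rev mset_sorted_list_of_multiset size_mset)
  finally show ?thesis
    unfolding eigval_def using B(2)
    by (intro sorted_desc_nth_ge) (auto simp: sorted_wrt_rev)
qed

section \<open>Laws of the observations and errors of a test\<close>

lemma prob_space_std_gauss: "prob_space (std_gauss :: (real^'d) measure)"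
  unfolding std_gauss_def
proof (rule prob_space.prob_space_distr)
  show "prob_space (\<Pi>\<^sub>M i\<in>(UNIV::'d set). density lborel std_normal_density)"
    by (intro prob_space_PiM prob_space_normal_density) simp
  have "(\<lambda>z. (\<chi> i. z i) \<bullet> b) \<in> borel_measurable (\<Pi>\<^sub>M i\<in>(UNIV::'d set). density lborel std_normal_density)"
    if b: "b \<in> Basis" for b :: "real^'d"
  proof -
    obtain j where j: "b = axis j 1"
      using b by (auto simp: Basis_vec_def)
    have "(\<lambda>z. z j) \<in> borel_measurable (\<Pi>\<^sub>M i\<in>(UNIV::'d set). density lborel std_normal_density)"
      using measurable_component_singleton[of j UNIV "\<lambda>_. density lborel std_normal_density"]
      by (simp cong: measurable_cong_sets)
    then show ?thesis
      by (simp add: j inner_axis)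
  qed
  then show "(\<lambda>z. \<chi> i. z i) \<in> (\<Pi>\<^sub>M i\<in>(UNIV::'d set). density lborel std_normal_density) \<rightarrow>\<^sub>M borel"
    by (subst borel_measurable_euclidean_space) auto
qed

text \<open>Multiplication by any fixed matrix is continuous, hence measurable, so the image of the
  standard Gaussian law keeps total mass 1.\<close>

lemma prob_space_centered_gauss: "prob_space (centered_gauss A)"
  unfolding centered_gauss_def
proof (rule prob_space.prob_space_distr[OF prob_space_std_gauss])
  have "(*v) (psd_sqrt A) \<in> borel_measurable borel"
    by (intro borel_measurable_continuous_onI matrix_vector_mult_linear_continuous_on)
  then show "(*v) (psd_sqrt A) \<in> std_gauss \<rightarrow>\<^sub>M borel"
    by (simp add: std_gauss_def)
qed

lemma prob_space_obs_law:
  fixes x0 :: "real^'d"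
  shows "prob_space (obs_law n x0 S)"
  unfolding obs_law_def
proof (rule prob_space.prob_space_distr)
  show "prob_space (increments_law n S)"
    unfolding increments_law_def by (intro prob_space_PiM prob_space_centered_gauss)
  have sets: "sets (increments_law n S) = sets (\<Pi>\<^sub>M i\<in>{1..n}. (borel :: (real^'d) measure))"
    unfolding increments_law_def by (intro sets_PiM_cong) (auto simp: centered_gauss_def)
  have "(\<lambda>w. \<lambda>i\<in>{0..n}. x0 + (\<Sum>j=1..i. w j)) \<in> (\<Pi>\<^sub>M i\<in>{1..n}. borel) \<rightarrow>\<^sub>M obs_space n"
  proof (rule measurable_restrict)
    fix i assume "i \<in> {0..n}"
    then show "(\<lambda>w. x0 + (\<Sum>j=1..i. w j)) \<in> (\<Pi>\<^sub>M i\<in>{1..n}. borel) \<rightarrow>\<^sub>M borel"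
      by (intro borel_measurable_add borel_measurable_const borel_measurable_sum
          measurable_component_singleton) auto
  qed
  then show "(\<lambda>w. \<lambda>i\<in>{0..n}. x0 + (\<Sum>j=1..i. w j)) \<in> increments_law n S \<rightarrow>\<^sub>M obs_space n"
    unfolding measurable_cong_sets[OF sets refl] .
qed

text \<open>The bounds by 1 keep the suprema over the hypotheses bounded above, as real suprema
  require; the identity is the balance of the two errors under one law.\<close>

lemma test_integral:
  assumes "\<phi> \<in> tests n"
  shows "(\<integral>y. \<phi> y \<partial>obs_law n x0 S) \<le> 1"
    and "(\<integral>y. (1 - \<phi> y) \<partial>obs_law n x0 S) \<le> 1"
    and "(\<integral>y. \<phi> y \<partial>obs_law n x0 S) + (\<integral>y. (1 - \<phi> y) \<partial>obs_law n x0 S) = 1"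
proof -
  interpret prob_space "obs_law n x0 S"
    by (rule prob_space_obs_law)
  have meas: "\<phi> \<in> borel_measurable (obs_law n x0 S)"
    using assms by (simp add: tests_def obs_law_def)
  have range: "\<phi> y \<in> {0..1}" if "y \<in> space (obs_law n x0 S)" for y
    using assms that by (auto simp: tests_def obs_law_def)
  have int: "integrable (obs_law n x0 S) \<phi>"
    by (rule integrable_const_bound[where B = 1]) (use meas range in \<open>auto intro!: AE_I2\<close>)
  show sum: "(\<integral>y. \<phi> y \<partial>obs_law n x0 S) + (\<integral>y. (1 - \<phi> y) \<partial>obs_law n x0 S) = 1"
    using int by (simp add: prob_space)
  have "0 \<le> (\<integral>y. \<phi> y \<partial>obs_law n x0 S)" "0 \<le> (\<integral>y. (1 - \<phi> y) \<partial>obs_law n x0 S)"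
    using range by (auto intro!: integral_nonneg)
  then show "(\<integral>y. \<phi> y \<partial>obs_law n x0 S) \<le> 1" "(\<integral>y. (1 - \<phi> y) \<partial>obs_law n x0 S) \<le> 1"
    using sum by linarith+
qed

text \<open>The degenerate case of the two-point method: each supremum dominates the error under the
  common law, where the errors sum to 1.\<close>

lemma error_sum_ge_1:
  assumes "\<phi> \<in> tests n" "S0 \<in> A" "S1 \<in> B" "obs_law n x0 S0 = obs_law n x0 S1"
  shows "(SUP S\<in>A. \<integral>y. \<phi> y \<partial>obs_law n x0 S) + (SUP S\<in>B. \<integral>y. (1 - \<phi> y) \<partial>obs_law n x0 S) \<ge> 1"
proof -
  have "(\<integral>y. \<phi> y \<partial>obs_law n x0 S0) \<le> (SUP S\<in>A. \<integral>y. \<phi> y \<partial>obs_law n x0 S)"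
    using assms(2) by (rule cSUP_upper) (use test_integral(1)[OF assms(1)] in \<open>auto intro!: bdd_aboveI2\<close>)
  moreover have "(\<integral>y. (1 - \<phi> y) \<partial>obs_law n x0 S1) \<le> (SUP S\<in>B. \<integral>y. (1 - \<phi> y) \<partial>obs_law n x0 S)"
    using assms(3) by (rule cSUP_upper) (use test_integral(2)[OF assms(1)] in \<open>auto intro!: bdd_aboveI2\<close>)
  ultimately show ?thesis
    using test_integral(3)[OF assms(1), of x0 S1] assms(4) by simp
qed

text \<open>The path enters the law only through the covariances of the increments, so oscillations
  that average out over each cell are invisible.\<close>

lemma obs_law_cong:
  assumes "\<And>i. i \<in> {1..n} \<Longrightarrow>
    (LINT t:{(real i - 1) / real n..real i / real n}|lebesgue. S t)
    = (LINT t:{(real i - 1) / real n..real i / real n}|lebesgue. T t)"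
  shows "obs_law n x0 S = obs_law n x0 T"
proof -
  have "increments_law n S = increments_law n T"
    unfolding increments_law_def by (rule PiM_cong) (simp_all only: assms)
  then show ?thesis
    by (simp add: obs_law_def)
qed

section \<open>From pointwise bounds to the Besov seminorm\<close>

lemma ennreal_powr_le:
  assumes "x \<le> ennreal (y powr p)" "0 < p" "0 \<le> y"
  shows "ennreal_powr x (1 / p) \<le> ennreal y"
proof -
  have "enn2real x \<le> y powr p"
    using assms(1) by (simp add: enn2real_leI)
  then have "enn2real x powr (1 / p) \<le> (y powr p) powr (1 / p)"
    using assms(2) by (intro powr_mono2) auto
  also have "\<dots> = y"
    using assms by (simp add: powr_powr)
  \<comment> \<open>The first premise makes \<open>x\<close> finite, which excludes the infinite
    branch of \<open>ennreal_powr\<close>.\<close>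
  finally show ?thesis
    using assms(1) by (auto simp: ennreal_powr_def ennreal_leI top_unique)
qed

text \<open>The domain of integration has length \<open>1 - s \<le> 1\<close>, so a uniform bound on
  the increments passes to every \<open>p\<close>-mean with the same constant, and
  \<open>h powr - \<beta>\<close> cancels the factor \<open>h powr \<beta>\<close>.\<close>

lemma besov_seminorm_le:
  fixes S :: "real \<Rightarrow> real^'d^'d"
  assumes "0 < p" "0 \<le> L"
    and bound: "\<And>h s t. 0 < h \<Longrightarrow> h \<le> 1 \<Longrightarrow> 0 \<le> s \<Longrightarrow> s \<le> h
      \<Longrightarrow> spectral_norm (S (t + s) - S t) \<le> L * h powr \<beta>"
  shows "besov_seminorm \<beta> p S \<le> ennreal L"
  unfolding besov_seminorm_def
proof (rule SUP_least)
  fix h :: real assume h: "h \<in> {0<..1}"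
  have "besov_modulus p S h \<le> ennreal (L * h powr \<beta>)"
    unfolding besov_modulus_def
  proof (rule SUP_least)
    fix s assume s: "s \<in> {0..h}"
    have "spectral_norm (S (t + s) - S t) powr p \<le> (L * h powr \<beta>) powr p" for t
      using bound[of h s t] h s assms(1)
      by (intro powr_mono2) (auto simp: spectral_norm_def onorm_pos_le)
    then have "(\<integral>\<^sup>+ t\<in>{0..1-s}. ennreal (spectral_norm (S (t + s) - S t) powr p) \<partial>lebesgue)
        \<le> (\<integral>\<^sup>+ t\<in>{0..1-s}. ennreal ((L * h powr \<beta>) powr p) \<partial>lebesgue)"
      by (intro nn_integral_mono mult_right_mono ennreal_leI) auto
    also have "\<dots> = ennreal ((L * h powr \<beta>) powr p) * ennreal (1 - s)"
      using h s by (simp add: nn_integral_cmult_indicator)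
    also have "\<dots> \<le> ennreal ((L * h powr \<beta>) powr p) * 1"
      using s by (intro mult_left_mono) (auto simp: ennreal_le_1)
    finally show "ennreal_powr (\<integral>\<^sup>+ t\<in>{0..1-s}. ennreal (spectral_norm (S (t + s) - S t) powr p) \<partial>lebesgue) (1 / p)
        \<le> ennreal (L * h powr \<beta>)"
      using assms by (intro ennreal_powr_le) auto
  qed
  then have "ennreal (h powr - \<beta>) * besov_modulus p S h \<le> ennreal (h powr - \<beta>) * ennreal (L * h powr \<beta>)"
    by (rule mult_left_mono) simp
  also have "\<dots> = ennreal L"
    using h assms(2) by (simp add: ennreal_mult[symmetric] powr_minus field_simps)
  finally show "ennreal (h powr - \<beta>) * besov_modulus p S h \<le> ennreal L" .
qed

section \<open>Eigenvalues and rank of a diagonal matrix plus a rank-one matrix\<close>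

definition diag_sq :: "('d \<Rightarrow> real) \<Rightarrow> real^'d^'d" where
  "diag_sq g = (\<chi> i j. if i = j then g i else 0)"

definition outer :: "real^'d \<Rightarrow> real^'d^'d" where
  "outer w = (\<chi> i j. w $ i * w $ j)"

lemma diag_sq_mult: "diag_sq g *v x = (\<chi> i. g i * x $ i)"
  by (simp add: diag_sq_def matrix_vector_mult_def vec_eq_iff if_distrib[of "\<lambda>z. z * _"] cong: if_cong)

lemma outer_mult: "outer w *v x = (w \<bullet> x) *\<^sub>R w"
  by (simp add: outer_def matrix_vector_mult_def vec_eq_iff inner_vec_def sum_distrib_left mult_ac)

lemma sym_psd_diag_sq:
  assumes "\<And>i. 0 \<le> g i"
  shows "diag_sq g \<in> sym_psd"
proof -
  have "0 \<le> x \<bullet> (diag_sq g *v x)" for x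
    using assms by (auto simp: diag_sq_mult inner_vec_def mult.left_commute intro!: sum_nonneg)
  then show ?thesis
    by (auto simp: sym_psd_def diag_sq_def transpose_def vec_eq_iff)
qed

lemma sym_psd_outer: "outer w \<in> sym_psd"
proof -
  have "0 \<le> x \<bullet> (outer w *v x)" for x
    by (simp add: outer_mult inner_commute)
  then show ?thesis
    by (simp add: sym_psd_def outer_def transpose_def vec_eq_iff mult.commute)
qed

lemma sym_psd_add:
  assumes "A \<in> sym_psd" "B \<in> sym_psd"
  shows "A + B \<in> sym_psd"
  using assms
  by (auto simp: sym_psd_def matrix_vector_mult_add_rdistrib inner_add_right transpose_def vec_eq_iff)

lemma independent_axes: "independent ((\<lambda>i. axis i (1::real)) ` I)"
  by (rule independent_mono[OF independent_Basis]) (auto simp: Basis_vec_def)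

lemma card_axes: "card ((\<lambda>i. axis i (1::real)) ` I) = card I"
  by (intro card_image inj_onI) (simp add: axis_eq_axis)

text \<open>The coordinate axes in \<open>I\<close> are independent eigenvectors with eigenvalues
  \<open>g i\<close>.\<close>

lemma eigval_diag_sq_ge:
  assumes "\<And>i. i \<in> I \<Longrightarrow> x \<le> g i" "1 \<le> k" "k \<le> card I"
  shows "x \<le> eigval k (diag_sq g)"
proof (rule eigval_ge[where B = "(\<lambda>i. axis i 1) ` I"])
  show "transpose (diag_sq g) = diag_sq g"
    by (simp add: diag_sq_def transpose_def vec_eq_iff)
  show "\<exists>l\<ge>x. diag_sq g *v v = l *\<^sub>R v" if "v \<in> (\<lambda>i. axis i 1) ` I" for v
    using that assms(1) by (force simp: diag_sq_mult axis_def vec_eq_iff)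
qed (use assms in \<open>auto simp: card_axes independent_axes\<close>)

text \<open>The range lies in the span of \<open>w\<close> and the axes in \<open>I\<close>.\<close>

lemma rank_diag_sq_add_outer_le:
  assumes "\<And>i. i \<notin> I \<Longrightarrow> g i = 0"
  shows "rank (diag_sq g + outer w) \<le> Suc (card I)"
proof -
  let ?W = "insert w ((\<lambda>i. axis i 1) ` I)"
  have "(diag_sq g + outer w) *v x \<in> span ?W" for x
  proof -
    have "diag_sq g *v x = (\<Sum>i\<in>I. (g i * x $ i) *\<^sub>R axis i 1)"
      using assms
      by (auto simp: diag_sq_mult vec_eq_iff axis_def if_distrib[of "\<lambda>z. _ * z"] cong: if_cong)
    also have "\<dots> \<in> span ?W"
      by (intro span_sum span_mul span_base) auto
    finally show ?thesis
      by (auto simp: matrix_vector_mult_add_rdistrib outer_mult intro: span_add span_mul span_base)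
  qed
  then have "rank (diag_sq g + outer w) \<le> card ?W"
    unfolding rank_dim_range by (intro dim_le_card) auto
  also have "\<dots> \<le> Suc (card I)"
    by (metis card_axes card_insert_le_m1 card_insert_if finite le_SucI order_refl finite_imageI)
  finally show ?thesis .
qed

text \<open>The supports of \<open>g\<close> and \<open>w\<close> are disjoint: the diagonal part
  kills \<open>w\<close> and the outer product kills the axes in \<open>I\<close>. Together these
  are \<open>Suc (card I)\<close> orthogonal eigenvectors, with eigenvalues
  \<open>w \<bullet> w\<close> and \<open>g i\<close>.\<close>

lemma eigval_diag_sq_add_outer_ge:
  assumes g: "\<And>i. i \<in> I \<Longrightarrow> x \<le> g i" "\<And>i. i \<notin> I \<Longrightarrow> g i = 0"
    and w: "\<And>i. i \<in> I \<Longrightarrow> w $ i = 0" "w \<noteq> 0" "x \<le> w \<bullet> w"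
    and k: "1 \<le> k" "k \<le> Suc (card I)"
  shows "x \<le> eigval k (diag_sq g + outer w)"
proof (rule eigval_ge[where B = "insert w ((\<lambda>i. axis i 1) ` I)"])
  let ?W = "insert w ((\<lambda>i. axis i 1) ` I)"
  show "transpose (diag_sq g + outer w) = diag_sq g + outer w"
    by (simp add: diag_sq_def outer_def transpose_def vec_eq_iff mult.commute)
  have "pairwise orthogonal ?W"
    using w(1) by (auto simp: pairwise_def orthogonal_def inner_axis inner_axis') (auto simp: axis_def)
  moreover have "0 \<notin> ?W"
    using w(2) by auto
  ultimately show "independent ?W"
    by (rule pairwise_orthogonal_independent)
  have "w \<notin> (\<lambda>i. axis i 1) ` I"
  proof
    assume "w \<in> (\<lambda>i. axis i 1) ` I"
    then obtain i where "i \<in> I" "w = axis i 1"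
      by blast
    then show False
      using w(1)[of i] by simp
  qed
  then show "k \<le> card ?W"
    using k by (simp add: card_axes)
  fix v assume "v \<in> ?W"
  then consider "v = w" | i where "i \<in> I" "v = axis i 1"
    by auto
  then show "\<exists>l\<ge>x. (diag_sq g + outer w) *v v = l *\<^sub>R v"
  proof cases
    case 1
    have "g i * w $ i = 0" for i
      using g(2) w(1) by (cases "i \<in> I") auto
    then have "diag_sq g *v w = 0"
      by (simp add: diag_sq_mult vec_eq_iff)
    then show ?thesis
      using 1 w(3) by (auto simp: matrix_vector_mult_add_rdistrib outer_mult)
  next
    case 2
    then have "diag_sq g *v v = g i *\<^sub>R v" "w \<bullet> v = 0"
      using w(1) by (auto simp: inner_axis) (auto simp: diag_sq_mult vec_eq_iff axis_def)
    then show ?thesis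
      using 2(1) g(1) by (auto simp: matrix_vector_mult_add_rdistrib outer_mult)
  qed
qed (use k in auto)

section \<open>Spectral norm of the oscillating terms\<close>

definition swap_mat :: "'d \<Rightarrow> 'd \<Rightarrow> real^'d^'d" where
  "swap_mat a b = (\<chi> i j. if i = a \<and> j = b \<or> i = b \<and> j = a then 1 else 0)"

text \<open>Sorts the outer product by powers of \<open>q\<close>, the coefficient that will
  oscillate: constant, linear and quadratic terms with fixed matrices.\<close>

lemma outer_axes:
  assumes "a \<noteq> b"
  shows "outer (p *\<^sub>R axis a 1 + q *\<^sub>R axis b 1)
    = diag_sq (\<lambda>i. if i = a then p\<^sup>2 else 0) + (p * q) *\<^sub>R swap_mat a b
      + q\<^sup>2 *\<^sub>R diag_sq (\<lambda>i. if i = b then 1 else 0)"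
  using assms
  by (auto simp: outer_def diag_sq_def swap_mat_def vec_eq_iff axis_def power2_eq_square)

text \<open>The matrix exchanges coordinates \<open>a\<close> and \<open>b\<close> and deletes all
  others, so the squared norm of the image is a partial sum of that of \<open>x\<close>.\<close>

lemma norm_swap_mat_le:
  assumes "a \<noteq> b"
  shows "norm (swap_mat a b *v x) \<le> norm (x :: real^'d)"
proof -
  have eq: "swap_mat a b *v x = x $ b *\<^sub>R axis a 1 + x $ a *\<^sub>R axis b 1"
  proof -
    have "(swap_mat a b *v x) $ i = (x $ b *\<^sub>R axis a 1 + x $ a *\<^sub>R axis b 1) $ i" for i
      using assms
      by (cases "i = a"; cases "i = b") (auto simp: swap_mat_def matrix_vector_mult_def axis_def
          if_distrib[of "\<lambda>z. z * _"] cong: if_cong)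
    then show ?thesis
      by (simp add: vec_eq_iff)
  qed
  have "(norm (swap_mat a b *v x))\<^sup>2 = (\<Sum>i\<in>{a, b}. (x $ i)\<^sup>2)"
    using assms unfolding eq power2_norm_eq_inner
    by (simp add: inner_add_left inner_add_right inner_axis_axis power2_eq_square)
  also have "\<dots> \<le> (\<Sum>i\<in>UNIV. (x $ i)\<^sup>2)"
    by (intro sum_mono2) auto
  also have "\<dots> = (norm x)\<^sup>2"
    unfolding power2_norm_eq_inner by (simp add: inner_vec_def power2_eq_square)
  finally show ?thesis
    by (rule power2_le_imp_le) simp
qed

lemma norm_diag_axis_le: "norm (diag_sq (\<lambda>i. if i = b then 1 else 0) *v x) \<le> norm (x :: real^'d)"
proof -
  have "diag_sq (\<lambda>i. if i = b then 1 else 0) *v x = x $ b *\<^sub>R axis b 1"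
    by (auto simp: diag_sq_mult vec_eq_iff axis_def)
  then show ?thesis
    by (simp add: component_le_norm_cart)
qed

text \<open>Triangle inequality, both matrices having operator norm at most 1.\<close>

lemma spectral_norm_comb_le:
  assumes "a \<noteq> b"
  shows "spectral_norm (p *\<^sub>R swap_mat a b + q *\<^sub>R diag_sq (\<lambda>i. if i = b then 1 else 0)) \<le> \<bar>p\<bar> + \<bar>q\<bar>"
  unfolding spectral_norm_def
proof (rule onorm_bound)
  fix x
  have "norm (p *\<^sub>R (swap_mat a b *v x) + q *\<^sub>R (diag_sq (\<lambda>i. if i = b then 1 else 0) *v x))
      \<le> \<bar>p\<bar> * norm x + \<bar>q\<bar> * norm x"
    using norm_swap_mat_le[OF assms, of x] norm_diag_axis_le[of b x]
    by (intro norm_triangle_mono) (auto intro: mult_left_mono)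
  then show "norm ((p *\<^sub>R swap_mat a b + q *\<^sub>R diag_sq (\<lambda>i. if i = b then 1 else 0)) *v x)
      \<le> (\<bar>p\<bar> + \<bar>q\<bar>) * norm x"
    by (simp add: matrix_vector_mult_add_rdistrib scaleR_matrix_vector_assoc[symmetric] algebra_simps)
qed simp

section \<open>Trigonometric estimates and cell integrals\<close>

lemma abs_cos_diff_le: "\<bar>cos x - cos (y::real)\<bar> \<le> 2 * min 1 \<bar>x - y\<bar>"
proof -
  have "\<bar>cos x - cos y\<bar> = 2 * (\<bar>sin ((x + y) / 2)\<bar> * \<bar>sin ((y - x) / 2)\<bar>)"
    by (simp add: cos_diff_cos abs_mult)
  \<comment> \<open>The half-angle gives \<open>\<bar>x - y\<bar> / 2\<close>; dropping the half
    puts this bound in the same form \<open>min 1 \<bar>x - y\<bar>\<close> as the one for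
    squares.\<close>
  also have "\<dots> \<le> 2 * (1 * min 1 \<bar>x - y\<bar>)"
    using abs_sin_x_le_abs_x[of "(y - x) / 2"] by (intro mult_left_mono mult_mono) auto
  finally show ?thesis by simp
qed

text \<open>Angle doubling reduces the difference to
  \<open>sin (x + y) * sin (y - x)\<close>.\<close>

lemma abs_cos_sq_diff_le: "\<bar>(cos x)\<^sup>2 - (cos (y::real))\<^sup>2\<bar> \<le> min 1 \<bar>x - y\<bar>"
proof -
  have "(cos x)\<^sup>2 - (cos y)\<^sup>2 = (cos (2 * x) - cos (2 * y)) / 2"
    by (simp add: cos_double_cos)
  also have "\<dots> = sin (x + y) * sin (y - x)"
  proof -
    have "(2 * x + 2 * y) / 2 = x + y" "(2 * y - 2 * x) / 2 = y - x"
      by simp_all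
    then show ?thesis
      unfolding cos_diff_cos[of "2 * x" "2 * y"] by (simp only:)
  qed
  finally have "\<bar>(cos x)\<^sup>2 - (cos y)\<^sup>2\<bar> = \<bar>sin (x + y)\<bar> * \<bar>sin (y - x)\<bar>"
    by (simp add: abs_mult)
  also have "\<dots> \<le> 1 * min 1 \<bar>x - y\<bar>"
    using abs_sin_x_le_abs_x[of "y - x"] by (intro mult_mono) auto
  finally show ?thesis by simp
qed

text \<open>A cell is half a period of the cosine and a full period of its square. The
  antiderivatives are multiples of \<open>sin (pi * real n * t)\<close> and
  \<open>sin (2 * (pi * real n * t))\<close>, which vanish at both ends of the cell.\<close>

lemma cell_integral_cos:
  fixes n i :: nat
  assumes "1 \<le> n" "1 \<le> i"
  shows "((\<lambda>t. cos (pi * real n * t)) has_integral 0) {(real i - 1) / real n..real i / real n}"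
    and "((\<lambda>t. (cos (pi * real n * t))\<^sup>2 - 1 / 2) has_integral 0) {(real i - 1) / real n..real i / real n}"
proof -
  let ?l = "(real i - 1) / real n" and ?u = "real i / real n"
  have le: "?l \<le> ?u"
    using assms by (simp add: divide_right_mono)
  have n: "pi * real n \<noteq> 0"
    using assms by simp
  \<comment> \<open>With \<open>i = Suc m\<close> the left end also becomes a natural multiple of
    \<open>pi\<close>.\<close>
  obtain m where m: "i = Suc m"
    using assms by (cases i) auto
  have ends: "pi * real n * ?l = real m * pi" "pi * real n * ?u = real i * pi"
    using assms m by auto
  have "((\<lambda>t. cos (pi * real n * t)) has_integral
      sin (pi * real n * ?u) / (pi * real n) - sin (pi * real n * ?l) / (pi * real n)) {?l..?u}"
    by (rule fundamental_theorem_of_calculus[OF le])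
      (use n in \<open>auto intro!: derivative_eq_intros simp flip: has_real_derivative_iff_has_vector_derivative\<close>)
  then show "((\<lambda>t. cos (pi * real n * t)) has_integral 0) {?l..?u}"
    unfolding ends by simp
  have half: "(cos y)\<^sup>2 - 1 / 2 = cos (2 * y) / 2" for y :: real
    unfolding cos_double_cos by simp
  have "((\<lambda>t. cos (2 * (pi * real n * t)) / 2) has_integral
      sin (2 * (pi * real n * ?u)) / (4 * (pi * real n)) - sin (2 * (pi * real n * ?l)) / (4 * (pi * real n))) {?l..?u}"
    by (rule fundamental_theorem_of_calculus[OF le])
      (use n in \<open>auto intro!: derivative_eq_intros simp flip: has_real_derivative_iff_has_vector_derivative\<close>)
  then show "((\<lambda>t. (cos (pi * real n * t))\<^sup>2 - 1 / 2) has_integral 0) {?l..?u}"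
    unfolding ends sin_double half by simp
qed

text \<open>Interpolation between boundedness and Lipschitz continuity, which yields the exponent
  \<open>\<beta>\<close>.\<close>

lemma min_1_le_powr:
  fixes x :: real
  assumes "0 < x" "0 < \<beta>" "\<beta> < 1"
  shows "min 1 x \<le> x powr \<beta>"
proof (cases "x \<le> 1")
  case True
  then show ?thesis
    using assms powr_mono'[of \<beta> 1 x] by simp
next
  case False
  then show ?thesis
    using assms ge_one_powr_ge_zero[of x \<beta>] by simp
qed

section \<open>The pair of paths with the same observation law\<close>

lemma const_mem_H1:
  fixes A :: "real^'d^'d"
  assumes "v \<le> eigval (r + 1) A" "A \<in> sym_psd" "hbar \<le> 1"
  shows "(\<lambda>_. A) \<in> H1 r hbar v"
proof -
  let ?X = "{(a, b). 0 \<le> a \<and> a \<le> b \<and> b \<le> 1 \<and> hbar \<le> b - a}"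
  let ?F = "\<lambda>(a, b). (b - a) * (INF t\<in>{a..b::real}. eigval (r + 1) A)"
  \<comment> \<open>Boundedness of the supremum in \<open>H1\<close>; the absolute value covers
    either sign of the eigenvalue.\<close>
  have le: "?F p \<le> \<bar>eigval (r + 1) A\<bar>" if "p \<in> ?X" for p
  proof -
    obtain a b where p: "p = (a, b)" "0 \<le> a" "a \<le> b" "b \<le> 1"
      using \<open>p \<in> ?X\<close> by auto
    have "(b - a) * eigval (r + 1) A \<le> (b - a) * \<bar>eigval (r + 1) A\<bar>"
      using p by (intro mult_left_mono) auto
    also have "\<dots> \<le> 1 * \<bar>eigval (r + 1) A\<bar>"
      using p by (intro mult_right_mono) auto
    finally show ?thesis
      using p by simp
  qed
  \<comment> \<open>The interval \<open>[0,1]\<close> is admissible because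
    \<open>hbar \<le> 1\<close>, and its factor \<open>b - a\<close> is 1.\<close>
  have "?F (0, 1) \<le> (SUP p\<in>?X. ?F p)"
    by (rule cSUP_upper) (use assms(3) le in \<open>auto intro!: bdd_aboveI2[where M = "\<bar>eigval (r + 1) A\<bar>"]\<close>)
  then show ?thesis
    using assms by (auto simp: H1_def)
qed

lemma indistinguishable_pair:
  fixes n r :: nat and \<beta> L K m hbar c :: real
  assumes n: "1 \<le> n" and r: "1 \<le> r" "r < CARD('d)" and \<beta>: "0 < \<beta>" "\<beta> < 1" and "0 < L" "hbar \<le> 1"
    and c: "0 < c" "c \<le> 2 powr (- 5 / 2) * inverse pi"
    and K: "K = c * L * real n powr - \<beta>" "K \<le> m"
  obtains S T :: "real \<Rightarrow> real^'d^'d"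
  where "S \<in> spd_paths" "\<And>t. rank (S t) \<le> r" "\<And>t. m \<le> eigval r (S t)"
    "\<And>p. 0 < p \<Longrightarrow> besov_seminorm \<beta> p S \<le> ennreal L"
    "T \<in> H1 r hbar (K\<^sup>2 / m)" "\<And>x0. obs_law n x0 S = obs_law n x0 T"
proof -
  have "0 < K"
    using K(1) assms by simp
  then have "0 < m"
    using K(2) by simp
  \<comment> \<open>With these choices the outer product has (a,a) entry \<open>m\<close>,
    off-diagonal entry \<open>sqrt 2 * K * f t\<close>, whose amplitude does not depend on
    \<open>m\<close>, and (b,b) entry \<open>2 * v * (f t)\<^sup>2\<close>, whose cell mean is
    \<open>v\<close>.\<close>
  define v where "v = K\<^sup>2 / m"
  define s where "s = sqrt m"
  define q where "q = sqrt 2 * K / s"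
  have s: "0 < s" "s\<^sup>2 = m" and q: "q\<^sup>2 = 2 * v" "s * q = sqrt 2 * K"
    using \<open>0 < m\<close> by (simp_all add: s_def q_def v_def power_mult_distrib power_divide)
  have v: "0 < v" "v \<le> K" "v \<le> m"
    using \<open>0 < K\<close> \<open>0 < m\<close> K(2) mult_left_mono[OF K(2), of K] mult_mono[OF K(2) K(2)]
    by (auto simp: v_def power2_eq_square field_simps)
  \<comment> \<open>\<open>J\<close> carries the \<open>r\<close> eigenvalues \<open>m\<close> of
    the constant path; \<open>b\<close>, available since \<open>r < CARD('d)\<close>, carries the
    additional eigenvalue \<open>v\<close>. The vector \<open>w\<close> lives on \<open>a\<close>
    and \<open>b\<close>.\<close>
  obtain J :: "'d set" where J: "card J = r"
    using r(2) obtain_subset_with_card_n[of r "UNIV :: 'd set"] by (metis less_imp_le)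
  obtain a where a: "a \<in> J"
    using J r(1) by fastforce
  obtain b where b: "b \<notin> J"
    using J r(2) by (metis UNIV_I less_irrefl subsetI subset_antisym top_greatest)
  have ab: "a \<noteq> b"
    using a b by auto
  define f where "f t = cos (pi * real n * t)" for t
  define w where "w t = s *\<^sub>R axis a 1 + (q * f t) *\<^sub>R (axis b 1 :: real^'d)" for t
  \<comment> \<open>\<open>g\<close> leaves out \<open>a\<close> because the outer product supplies
    the entry \<open>m\<close> there; \<open>g1\<close> includes it.\<close>
  define g where "g i = (if i \<in> J - {a} then m else 0)" for i
  define g1 where "g1 i = (if i \<in> J then m else if i = b then v else 0)" for i
  define P where "P = diag_sq (\<lambda>i. if i = b then 1 else 0 :: real)"
  define S where "S t = diag_sq g + outer (w t)" for t
  define T where "T = (\<lambda>_ :: real. diag_sq g1)"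
  \<comment> \<open>Apart from the constant \<open>T\<close>, only \<open>f\<close> and
    \<open>(f t)\<^sup>2 - 1 / 2\<close> times fixed matrices remain. This form serves both the
    increments of \<open>S\<close> and its cell integrals.\<close>
  have ST: "S t = T t + (f t *\<^sub>R ((sqrt 2 * K) *\<^sub>R swap_mat a b) + ((f t)\<^sup>2 - 1 / 2) *\<^sub>R ((2 * v) *\<^sub>R P))" for t
  proof -
    have "S t = diag_sq g + (diag_sq (\<lambda>i. if i = a then s\<^sup>2 else 0) + (s * (q * f t)) *\<^sub>R swap_mat a b
        + (q * f t)\<^sup>2 *\<^sub>R P)"
      by (simp add: S_def w_def P_def outer_axes[OF ab])
    moreover have "s * (q * f t) = f t * (sqrt 2 * K)" "(q * f t)\<^sup>2 = (f t)\<^sup>2 * (2 * v)"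
      using q by (auto simp: power_mult_distrib mult.assoc[symmetric])
    moreover have "diag_sq g + diag_sq (\<lambda>i. if i = a then s\<^sup>2 else 0) = diag_sq g1 - v *\<^sub>R P"
      using a b s by (auto simp: diag_sq_def vec_eq_iff g_def g1_def P_def)
    moreover have "((f t)\<^sup>2 - 1 / 2) * (2 * v) = (f t)\<^sup>2 * (2 * v) - v"
      by (simp add: algebra_simps)
    ultimately show ?thesis
      by (simp add: T_def scaleR_left_diff_distrib add.assoc[symmetric])
  qed
  have cont: "continuous_on A S" for A
    unfolding ST T_def f_def by (intro continuous_intros)
  have psd: "S t \<in> sym_psd" for t
    unfolding S_def using \<open>0 < m\<close>
    by (intro sym_psd_add sym_psd_diag_sq sym_psd_outer) (auto simp: g_def)
  have w0: "w t $ i = 0" if "i \<in> J - {a}" for i t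
    using that b by (auto simp: w_def axis_def)
  \<comment> \<open>The squared length is \<open>m + (q * f t)\<^sup>2\<close>, so the oscillation
    never lowers the eigenvalue belonging to \<open>w\<close>.\<close>
  have ww: "m \<le> w t \<bullet> w t" for t
    using ab s by (simp add: w_def inner_add_left inner_add_right inner_axis_axis flip: power2_eq_square)
  have card: "Suc (card (J - {a})) = r"
    using a J r(1) by (simp add: card_Diff_singleton)
  show thesis
  proof (rule that)
    show "S \<in> spd_paths"
      using psd cont by (auto simp: spd_paths_def intro: absolutely_integrable_continuous_real)
    show "rank (S t) \<le> r" for t
      unfolding S_def card[symmetric] by (rule rank_diag_sq_add_outer_le) (auto simp: g_def)
    have "w t \<noteq> 0" for t
      using ww[of t] \<open>0 < m\<close> by auto
    then show "m \<le> eigval r (S t)" for t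
      unfolding S_def using w0 ww r(1) card
      by (intro eigval_diag_sq_add_outer_ge[where I = "J - {a}"]) (auto simp: g_def)
    show "besov_seminorm \<beta> p S \<le> ennreal L" if "0 < p" for p
    proof (rule besov_seminorm_le[OF that])
      fix h u t :: real assume h: "0 < h" "h \<le> 1" "0 \<le> u" "u \<le> h"
      define z where "z = min 1 (pi * real n * h)"
      have z: "min 1 \<bar>pi * real n * (t + u) - pi * real n * t\<bar> \<le> z"
        using h unfolding z_def by (intro min.mono) (auto simp: distrib_left abs_mult mult_left_mono)
      have "S (t + u) - S t = ((f (t + u) - f t) * (sqrt 2 * K)) *\<^sub>R swap_mat a b
          + (((f (t + u))\<^sup>2 - (f t)\<^sup>2) * (2 * v)) *\<^sub>R P"
        unfolding ST by (simp add: T_def algebra_simps)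
      then have "spectral_norm (S (t + u) - S t)
          \<le> \<bar>(f (t + u) - f t) * (sqrt 2 * K)\<bar> + \<bar>((f (t + u))\<^sup>2 - (f t)\<^sup>2) * (2 * v)\<bar>"
        unfolding P_def by (simp only: spectral_norm_comb_le[OF ab])
      \<comment> \<open>Here \<open>v \<le> K\<close>, a consequence of \<open>K \<le> m\<close>,
        bounds the quadratic term by the same scale \<open>K\<close> as the linear one.\<close>
      also have "\<dots> \<le> (2 * z) * (sqrt 2 * K) + z * (2 * K)"
        unfolding abs_mult
        using abs_cos_diff_le[of "pi * real n * (t + u)" "pi * real n * t"]
          abs_cos_sq_diff_le[of "pi * real n * (t + u)" "pi * real n * t"] z v \<open>0 < K\<close>
        by (intro add_mono mult_mono) (auto simp: f_def)
      also have "\<dots> = (2 * sqrt 2 + 2) * K * z"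
        by (simp add: algebra_simps)
      \<comment> \<open>Since \<open>1 \<le> sqrt 2\<close>, both terms fit into
        \<open>4 * sqrt 2\<close>, which is \<open>2 powr (5 / 2)\<close>: the constant in the
        condition on \<open>c\<close>.\<close>
      also have "\<dots> \<le> (4 * sqrt 2) * K * z"
        using \<open>0 < K\<close> h by (intro mult_right_mono) (auto simp: z_def)
      also have "z \<le> pi powr \<beta> * real n powr \<beta> * h powr \<beta>"
        using min_1_le_powr[of "pi * real n * h" \<beta>] n h \<beta> by (simp add: z_def powr_mult)
      \<comment> \<open>This makes the constant free of \<open>\<beta>\<close> and is the source of
        the factor \<open>inverse pi\<close> in the bound on \<open>c\<close>.\<close>
      also have "pi powr \<beta> \<le> pi"
        using powr_mono[of \<beta> 1 pi] \<beta> pi_gt3 by simp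
      \<comment> \<open>The factor \<open>real n powr \<beta>\<close> cancels the decay of
        \<open>K\<close> in \<open>n\<close>.\<close>
      also have "4 * sqrt 2 * K * (pi * real n powr \<beta> * h powr \<beta>) = (4 * sqrt 2 * (c * pi)) * (L * h powr \<beta>)"
        using n by (simp add: K(1) powr_minus field_simps)
      also have "\<dots> \<le> 1 * (L * h powr \<beta>)"
      proof (rule mult_right_mono)
        have "2 powr (2 + 1 / 2) = 2 powr 2 * 2 powr (1 / 2 :: real)"
          by (rule powr_add)
        then have "2 powr (5 / 2) = 4 * sqrt (2 :: real)"
          by (simp add: powr_half_sqrt)
        then have "4 * sqrt 2 * (c * pi) \<le> 2 powr (5 / 2) * (2 powr (- 5 / 2) :: real)"
          using c by (intro mult_mono) (auto simp: field_simps)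
        also have "\<dots> = 1"
          by (simp flip: powr_add)
        finally show "4 * sqrt 2 * (c * pi) \<le> 1" .
      qed (use \<open>0 < L\<close> in simp)
      \<comment> \<open>Replacing \<open>z\<close> and \<open>pi powr \<beta>\<close> inside
        products left monotonicity premises, which are discharged here.\<close>
      finally show "spectral_norm (S (t + u) - S t) \<le> L * h powr \<beta>"
        using \<open>0 < K\<close> by (simp add: mult_left_mono mult_right_mono)
    qed (use \<open>0 < L\<close> in simp)
    \<comment> \<open>The set \<open>insert b J\<close> has \<open>r + 1\<close> elements, and
      \<open>v \<le> m\<close> makes all their diagonal entries at least \<open>v\<close>.\<close>
    have "v \<le> eigval (r + 1) (diag_sq g1)"
      using J b v by (intro eigval_diag_sq_ge[where I = "insert b J"]) (auto simp: g1_def)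
    moreover have "diag_sq g1 \<in> sym_psd"
      using v \<open>0 < m\<close> by (intro sym_psd_diag_sq) (auto simp: g1_def)
    ultimately show "T \<in> H1 r hbar (K\<^sup>2 / m)"
      unfolding T_def v_def using \<open>hbar \<le> 1\<close> by (intro const_mem_H1)
    show "obs_law n x0 S = obs_law n x0 T" for x0
    proof (rule obs_law_cong)
      fix i assume i: "i \<in> {1..n}"
      let ?I = "{(real i - 1) / real n..real i / real n}"
      have int: "A absolutely_integrable_on ?I" if "continuous_on ?I A" for A :: "real \<Rightarrow> real^'d^'d"
        using that by (rule absolutely_integrable_continuous_real)
      have "(T has_integral integral ?I T) ?I"
        unfolding T_def by (intro integrable_integral integrable_continuous_real continuous_intros)
      moreover have "((\<lambda>t. f t *\<^sub>R ((sqrt 2 * K) *\<^sub>R swap_mat a b)) has_integral 0) ?I"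
        using has_integral_scaleR_left[OF cell_integral_cos(1)[OF n, of i]] i by (simp add: f_def del: scaleR_scaleR)
      moreover have "((\<lambda>t. ((f t)\<^sup>2 - 1 / 2) *\<^sub>R ((2 * v) *\<^sub>R P)) has_integral 0) ?I"
        using has_integral_scaleR_left[OF cell_integral_cos(2)[OF n, of i]] i by (simp add: f_def del: scaleR_scaleR)
      ultimately have "(S has_integral integral ?I T + (0 + 0)) ?I"
        unfolding ST by (intro has_integral_add)
      then have "integral ?I S = integral ?I T"
        by (simp add: integral_unique)
      \<comment> \<open>Both paths are continuous, so on a cell the Lebesgue integral agrees with
        the gauge integral.\<close>
      then show "(LINT t:?I|lebesgue. S t) = (LINT t:?I|lebesgue. T t)"
        using set_lebesgue_integral_eq_integral(2)[OF int[OF cont]]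
          set_lebesgue_integral_eq_integral(2)[OF int[of T]] by (simp add: T_def)
    qed
  qed
qed

section \<open>The two non-testability bounds\<close>

theorem proposition3p9:
  fixes n r :: nat and \<beta> L lr hbar c :: real and x0 :: "real^'d"
  assumes "1 \<le> n" "1 \<le> r" "r < CARD('d)"
    and "0 < \<beta>" "\<beta> < 1" "0 < L" "0 < lr" "0 < hbar" "hbar \<le> 1"
    and "0 < c" "c \<le> 2 powr (- 5 / 2) * inverse pi"
  shows "(\<forall>\<phi>\<in>tests n.
      (SUP S\<in>H0 r \<beta> L. \<integral>y. \<phi> y \<partial>obs_law n x0 S)
      + (SUP S\<in>H1 r hbar (c * L * real n powr - \<beta>). \<integral>y. (1 - \<phi> y) \<partial>obs_law n x0 S) \<ge> 1)
    \<and> (\<forall>\<phi>\<in>tests n.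
      (SUP S\<in>H0_gap r \<beta> L lr. \<integral>y. \<phi> y \<partial>obs_law n x0 S)
      + (SUP S\<in>H1 r hbar (min (inverse lr * c\<^sup>2 * L\<^sup>2 * real n powr (- 2 * \<beta>)) (c * L * real n powr - \<beta>)).
          \<integral>y. (1 - \<phi> y) \<partial>obs_law n x0 S) \<ge> 1)"
proof (intro conjI ballI)
  define K where "K = c * L * real n powr - \<beta>"
  have "0 < K"
    using assms by (simp add: K_def)
  note pair = indistinguishable_pair[OF assms(1-6,9-11) K_def]
  {
    fix \<phi> :: "(nat \<Rightarrow> real^'d) \<Rightarrow> real" assume \<phi>: "\<phi> \<in> tests n"
    obtain S T :: "real \<Rightarrow> real^'d^'d" where ST: "S \<in> spd_paths" "\<And>t. rank (S t) \<le> r"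
      "\<And>t. K \<le> eigval r (S t)" "\<And>p. 0 < p \<Longrightarrow> besov_seminorm \<beta> p S \<le> ennreal L"
      "T \<in> H1 r hbar (K\<^sup>2 / K)" "\<And>x0 :: real^'d. obs_law n x0 S = obs_law n x0 T"
      by (rule pair[OF order_refl]) (rule that)
    \<comment> \<open>The Besov bound is taken at \<open>p = 2\<close>; the pointwise rank bound
      passes to the supremum over the nonempty interval.\<close>
    have "S \<in> H0 r \<beta> L"
      using ST by (auto simp: H0_def intro: cSUP_least)
    moreover have "T \<in> H1 r hbar (c * L * real n powr - \<beta>)"
      using ST(5) \<open>0 < K\<close> by (simp add: power2_eq_square K_def[symmetric])
    ultimately show "(SUP S\<in>H0 r \<beta> L. \<integral>y. \<phi> y \<partial>obs_law n x0 S)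
      + (SUP S\<in>H1 r hbar (c * L * real n powr - \<beta>). \<integral>y. (1 - \<phi> y) \<partial>obs_law n x0 S) \<ge> 1"
      using error_sum_ge_1[OF \<phi> _ _ ST(6)] by simp
  next
    fix \<phi> :: "(nat \<Rightarrow> real^'d) \<Rightarrow> real" assume \<phi>: "\<phi> \<in> tests n"
    obtain S T :: "real \<Rightarrow> real^'d^'d" where ST: "S \<in> spd_paths" "\<And>t. rank (S t) \<le> r"
      "\<And>t. max lr K \<le> eigval r (S t)" "\<And>p. 0 < p \<Longrightarrow> besov_seminorm \<beta> p S \<le> ennreal L"
      "T \<in> H1 r hbar (K\<^sup>2 / max lr K)" "\<And>x0 :: real^'d. obs_law n x0 S = obs_law n x0 T"
      by (rule pair[OF max.cobounded2]) (rule that)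
    \<comment> \<open>Now \<open>p = 4\<close>, and the gap holds because
      \<open>lr \<le> max lr K\<close>.\<close>
    have "S \<in> H0_gap r \<beta> L lr"
      using ST by (auto simp: H0_gap_def intro: cSUP_least cINF_greatest)
    moreover have "K\<^sup>2 / max lr K = min (inverse lr * c\<^sup>2 * L\<^sup>2 * real n powr (- 2 * \<beta>)) (c * L * real n powr - \<beta>)"
    proof -
      have "inverse lr * c\<^sup>2 * L\<^sup>2 * real n powr (- 2 * \<beta>) = K\<^sup>2 / lr"
        by (simp add: K_def power2_eq_square divide_inverse mult_ac flip: powr_add)
      \<comment> \<open>Dividing by the larger of two positive numbers gives the smaller quotient,
        and \<open>K\<^sup>2 / K = K\<close>.\<close>
      moreover have "K\<^sup>2 / max lr K = min (K\<^sup>2 / lr) K"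
        using \<open>0 < K\<close> \<open>0 < lr\<close> by (auto simp: min_def max_def power2_eq_square field_simps)
      ultimately show ?thesis
        by (simp add: K_def)
    qed
    ultimately show "(SUP S\<in>H0_gap r \<beta> L lr. \<integral>y. \<phi> y \<partial>obs_law n x0 S)
      + (SUP S\<in>H1 r hbar (min (inverse lr * c\<^sup>2 * L\<^sup>2 * real n powr (- 2 * \<beta>)) (c * L * real n powr - \<beta>)).
          \<integral>y. (1 - \<phi> y) \<partial>obs_law n x0 S) \<ge> 1"
      using error_sum_ge_1[OF \<phi> _ _ ST(6)] ST(5) by simp
  }
qed

end
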